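(* Let $p$ be a prime. For every real number $c<\frac12-\frac1{2p}$ there exists $A\subseteq\mathbb F_p^{\omega}$ such that $d^*(A)>c$ and $A-A$ does not contain a Bohr neighborhood.
   Context: $\mathbb F_p^{\omega}=\bigoplus_{n=1}^{\infty}\mathbb F_p$ is the countable direct sum of copies of the field with $p$ elements, viewed as a countable abelian group. For subsets of an abelian group $G$ and $t\in G$: $A-A=\{a-b:a,b\in A\}$, $t+A=\{t+a:a\in A\}$. A Følner sequence for a countable abelian group $G$ is a sequence $\mathbf\Phi=(\Phi_n)_{n\in\mathbb N}$ of finite (nonempty) subsets of $G$ with $\lim_{n\to\infty}\frac{|(\Phi_n+g)\cap\Phi_n|}{|\Phi_n|}=1$ for every $g\in G$. The upper Banach density of $A\subseteq G$ is $d^*(A)=\sup_{\mathbf\Phi}\limsup_{n\to\infty}\frac{|A\cap\Phi_n|}{|\Phi_n|}$, the supremum being over all Følner sequences for $G$. A Bohr set in $G$ is a set of the form $\{g\in G:|\chi_j(g)-1|<\varepsilon,\ 1\le j\le k\}$, where $\varepsilon>0$ and $\chi_1,\dots,\chi_k:G\to\mathcal S^1=\{z\in\mathbb C:|z|=1\}$ are homomorphisms. A Bohr neighborhood is a set containing a translate $g+U$ ($g\in G$) of a Bohr set $U$. *)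

theory Defs
  imports "HOL-Algebra.Algebra" "HOL-Analysis.Analysis" "HOL-Computational_Algebra.Primes"
begin

text \<open>
  Abelian groups are HOL-Algebra groups with explicit carriers, hence written multiplicatively:
  the additive $g + h$ and $a - b$ are \<open>g \<otimes> h\<close> and \<open>a \<otimes> inv b\<close>, and the translate $g + U$ is the
  coset \<open>g <# U\<close>.
\<close>

text \<open>
  Elements are the finitely supported functions from \<^typ>\<open>nat\<close> to the residues \<open>{0..<p}\<close>
  (for \<open>p > 0\<close>), added pointwise modulo \<open>p\<close>.
\<close>

definition Fp_omega :: "nat \<Rightarrow> (nat \<Rightarrow> int) monoid" where
  "Fp_omega p = sum_group UNIV (\<lambda>_. integer_mod_group p)"

lemma comm_group_Fp_omega: "comm_group (Fp_omega p)"
  unfolding Fp_omega_def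
  by (rule group.group_comm_groupI) (simp_all add: add.commute)

lemma carrier_Fp_omega:
  assumes "p > 0"
  shows "carrier (Fp_omega p) = {x. (\<forall>i. x i \<in> {0..<int p}) \<and> finite {i. x i \<noteq> 0}}"
  using assms
  by (auto simp: Fp_omega_def carrier_sum_group carrier_integer_mod_group PiE_def Pi_def)

lemma mult_Fp_omega:
  assumes "p > 0"
  shows "x \<otimes>\<^bsub>Fp_omega p\<^esub> y = (\<lambda>i. (x i + y i) mod int p)"
  using assms by (simp add: Fp_omega_def mult_integer_mod_group restrict_def)

definition difference_set :: "('a, 'b) monoid_scheme \<Rightarrow> 'a set \<Rightarrow> 'a set" where
  "difference_set G A = {a \<otimes>\<^bsub>G\<^esub> inv\<^bsub>G\<^esub> b | a b. a \<in> A \<and> b \<in> A}"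

definition Folner_sequence :: "('a, 'b) monoid_scheme \<Rightarrow> (nat \<Rightarrow> 'a set) \<Rightarrow> bool" where
  "Folner_sequence G \<Phi> \<longleftrightarrow>
     (\<forall>n. finite (\<Phi> n) \<and> \<Phi> n \<noteq> {} \<and> \<Phi> n \<subseteq> carrier G) \<and>
     (\<forall>g\<in>carrier G.
        (\<lambda>n. real (card ((\<Phi> n #>\<^bsub>G\<^esub> g) \<inter> \<Phi> n)) / real (card (\<Phi> n))) \<longlonglongrightarrow> 1)"

text \<open>Taken in \<^typ>\<open>ereal\<close> because \<^const>\<open>limsup\<close> needs a complete linear order.\<close>

definition upper_Banach_density :: "('a, 'b) monoid_scheme \<Rightarrow> 'a set \<Rightarrow> ereal" where
  "upper_Banach_density G A =
     (SUP \<Phi> \<in> {\<Phi>. Folner_sequence G \<Phi>}.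
        limsup (\<lambda>n. ereal (real (card (A \<inter> \<Phi> n)) / real (card (\<Phi> n)))))"

definition circle_group :: "complex monoid" where
  "circle_group = \<lparr>carrier = {z. cmod z = 1}, monoid.mult = (*), one = 1\<rparr>"

definition Bohr_set :: "('a, 'b) monoid_scheme \<Rightarrow> 'a set \<Rightarrow> bool" where
  "Bohr_set G U \<longleftrightarrow>
     (\<exists>(\<epsilon>::real) (k::nat) \<psi>. \<epsilon> > 0 \<and> (\<forall>j\<in>{1..k}. \<psi> j \<in> hom G circle_group) \<and>
        U = {g \<in> carrier G. \<forall>j\<in>{1..k}. cmod (\<psi> j g - 1) < \<epsilon>})"

definition Bohr_neighborhood :: "('a, 'b) monoid_scheme \<Rightarrow> 'a set \<Rightarrow> bool" where
  "Bohr_neighborhood G B \<longleftrightarrow>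
     B \<subseteq> carrier G \<and> (\<exists>g\<in>carrier G. \<exists>U. Bohr_set G U \<and> g <#\<^bsub>G\<^esub> U \<subseteq> B)"

end

theory Submission
  imports Defs
begin

text \<open>
  To say that the difference set of \<open>A\<close> contains no Bohr neighborhood is to say that its complement
  meets every one of them. The proof builds \<open>A\<close> together with such an avoided set.

  \<^bold>\<open>The avoided set.\<close> A character of the group takes only \<open>p\<close>-th roots of unity as values, so finitely
  many characters together take finitely many values, say at most \<open>q\<close> of them. A pigeonhole argument
  then shows that in any block \<open>B\<close> of coordinates the all-ones vector can be moved into the common
  kernel of these characters by changing at most \<open>q\<close> ones into zeros
  (\<open>delete_few_to_trivialize_products\<close>). Cut the coordinates into consecutive blocks, and attach to
  block \<open>j\<close> a vector \<open>h j\<close> supported in front of the block, so that every group element occurs as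
  \<open>h j\<close> for arbitrarily large \<open>j\<close>. Then the vectors \<open>h j + u\<close>, where \<open>u\<close> is a zero-one vector on block
  \<open>j\<close> with at most \<open>j\<close> zeros there, meet every Bohr neighborhood.

  \<^bold>\<open>The set.\<close> Let the coordinates in a block vote for their value modulo \<open>p\<close>. Adding the all-ones
  vector turns the winner \<open>a\<close> into \<open>a + 1\<close>, and a winner with a margin above \<open>2 * j\<close> still does so
  after \<open>j\<close> coordinates are altered (\<open>wins_translate_one\<close>). Start with the set of \<open>x\<close> whose coordinate
  \<open>0\<close> lies in \<open>{0..<p div 2}\<close>; it is disjoint from its translate by \<open>half\<close>, the vector with the
  single entry \<open>p div 2\<close> in coordinate \<open>0\<close>. At block \<open>j\<close>, translate the set built so far by
  \<open>a * (h j + half)\<close> in the fibre over each word with winner \<open>a\<close>, and leave the fibre empty when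
  there is no clear winner. If two elements of the new set differed by \<open>h j + u\<close>, their
  winners would be \<open>a\<close> and \<open>a + 1\<close>, and after undoing the translations two elements of the previous
  set would differ by \<open>half\<close>. Translating all of a fibre by the same vector creates no new
  differences inside it, so \<open>half\<close> is never a difference, and the vectors avoided at
  earlier blocks remain avoided (\<open>descend\<close>).

  \<^bold>\<open>The density.\<close> The initial density \<open>(p div 2) / p\<close> is at least \<open>1/2 - 1/(2p)\<close>, and block \<open>j\<close> loses
  only the fraction of words without a clear winner. That fraction tends to \<open>0\<close> as the block grows
  (\<open>eventually_few_without_winner\<close>), because the difference of the votes for two values performs a
  random walk, which spreads out. Long blocks make the total loss as small as desired.
\<close>

section \<open>Words and votes\<close>

definition words :: "nat \<Rightarrow> nat set \<Rightarrow> (nat \<Rightarrow> int) set" where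
  "words p I = {x. (\<forall>i\<in>I. x i \<in> {0..<int p}) \<and> (\<forall>i. i \<notin> I \<longrightarrow> x i = 0)}"

definition votes :: "nat \<Rightarrow> nat set \<Rightarrow> (nat \<Rightarrow> int) \<Rightarrow> int \<Rightarrow> nat" where
  "votes p I x a = card {i \<in> I. x i mod int p = a mod int p}"

text \<open>
  The candidate \<open>a\<close> stands for its residue class modulo \<open>p\<close>. All of the construction works with
  integer vectors up to congruence, so that translations need no reduction.
\<close>

definition wins :: "nat \<Rightarrow> nat set \<Rightarrow> nat \<Rightarrow> (nat \<Rightarrow> int) \<Rightarrow> int \<Rightarrow> bool" where
  "wins p I K x a \<longleftrightarrow> (\<forall>b. b mod int p \<noteq> a mod int p \<longrightarrow> votes p I x b + K < votes p I x a)"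

lemma words_empty [simp]: "words p {} = {\<lambda>_. 0}"
  by (auto simp: words_def)

lemma words_insert:
  assumes "i \<notin> I"
  shows "bij_betw (\<lambda>(v, x). x(i := v)) ({0..<int p} \<times> words p I) (words p (insert i I))"
proof (rule bij_betw_byWitness[where f' = "\<lambda>x. (x i, x(i := 0))"])
  show "\<forall>a\<in>{0..<int p} \<times> words p I. (\<lambda>x. (x i, x(i := 0))) (case a of (v, x) \<Rightarrow> x(i := v)) = a"
    using assms by (auto simp: words_def fun_eq_iff)
  show "\<forall>a'\<in>words p (insert i I). (case (a' i, a'(i := 0)) of (v, x) \<Rightarrow> x(i := v)) = a'"
    by auto
  show "(\<lambda>(v, x). x(i := v)) ` ({0..<int p} \<times> words p I) \<subseteq> words p (insert i I)"
    by (auto simp: words_def)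
  show "(\<lambda>x. (x i, x(i := 0))) ` words p (insert i I) \<subseteq> {0..<int p} \<times> words p I"
    by (auto simp: words_def)
qed

lemma sum_words_insert:
  assumes "i \<notin> I"
  shows "(\<Sum>x\<in>words p (insert i I). f x) = (\<Sum>x\<in>words p I. \<Sum>v\<in>{0..<int p}. f (x(i := v)))"
proof -
  have "(\<Sum>x\<in>words p (insert i I). f x)
      = (\<Sum>(v, x)\<in>{0..<int p} \<times> words p I. f (x(i := v)))"
    using sum.reindex_bij_betw[OF words_insert[OF assms], of f p]
    by (simp add: case_prod_unfold)
  also have "\<dots> = (\<Sum>x\<in>words p I. \<Sum>v\<in>{0..<int p}. f (x(i := v)))"
    by (subst sum.swap) (simp add: sum.cartesian_product)
  finally show ?thesis .
qed

lemma finite_words_and_card: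
  assumes "finite I"
  shows finite_words: "finite (words p I)" and card_words: "card (words p I) = p ^ card I"
proof -
  have "finite (words p I) \<and> card (words p I) = p ^ card I"
    using assms
  proof (induction I rule: finite_induct)
    case (insert i I)
    show ?case
      using bij_betw_finite[OF words_insert[OF insert.hyps(2), of p]]
        bij_betw_same_card[OF words_insert[OF insert.hyps(2), of p]] insert
      by (simp add: card_cartesian_product)
  qed simp
  then show "finite (words p I)" "card (words p I) = p ^ card I" by auto
qed

lemma votes_insert:
  assumes "finite I" "i \<notin> I"
  shows "votes p (insert i I) (x(i := v)) a
    = votes p I x a + (if v mod int p = a mod int p then 1 else 0)"
proof -
  have "{j \<in> insert i I. (x(i := v)) j mod int p = a mod int p}
      = (if v mod int p = a mod int p then insert i {j \<in> I. x j mod int p = a mod int p}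
         else {j \<in> I. x j mod int p = a mod int p})"
    using assms by auto
  then show ?thesis using assms by (simp add: votes_def)
qed

section \<open>Anticoncentration of vote differences\<close>

text \<open>
  The number of walks of \<open>t\<close> steps \<open>+1\<close> or \<open>-1\<close> from \<open>0\<close> to \<open>d\<close>.
\<close>

definition walk_count :: "nat \<Rightarrow> int \<Rightarrow> real" where
  "walk_count t d =
     (if even (int t + d) \<and> 0 \<le> int t + d then real (t choose nat ((int t + d) div 2)) else 0)"

lemma walk_count_eq_binomial: "int t + d = 2 * int k \<Longrightarrow> walk_count t d = real (t choose k)"
  by (simp add: walk_count_def)

lemma walk_count_0: "walk_count 0 d = (if d = 0 then 1 else 0)"
proof (cases "even d \<and> 0 \<le> d")
  case True
  then obtain k where "d = 2 * k" "0 \<le> k" by (auto elim!: evenE)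
  then obtain m where m: "d = 2 * int m" by (metis nonneg_int_cases)
  then have "walk_count 0 d = real (0 choose m)" by (simp add: walk_count_eq_binomial)
  then show ?thesis using m by (cases m) auto
qed (auto simp: walk_count_def)

lemma walk_count_Suc: "walk_count (Suc t) d = walk_count t (d - 1) + walk_count t (d + 1)"
proof (cases "odd (int t + d + 1) \<or> int t + d + 1 < 0")
  case True
  then show ?thesis by (auto simp: walk_count_def algebra_simps)
next
  case False
  then obtain k where "int t + d + 1 = 2 * k" by blast
  moreover from this False have "k \<ge> 0" by simp
  ultimately obtain m where m: "int t + d + 1 = 2 * int m" by (metis nonneg_int_cases)
  then have d: "d = 2 * int m - int t - 1" by simp
  show ?thesis
  proof (cases m)
    case 0
    then show ?thesis by (simp add: d walk_count_def)
  next
    case (Suc k)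
    have "int (Suc t) + d = 2 * int (Suc k)" "int t + (d - 1) = 2 * int k"
      "int t + (d + 1) = 2 * int (Suc k)"
      using d Suc by auto
    from this[THEN walk_count_eq_binomial] show ?thesis by simp
  qed
qed

lemma walk_count_le: "walk_count t d \<le> real (t choose (t div 2))"
  by (simp add: walk_count_def binomial_maximum)

text \<open>
  Squaring removes the square root from the classical bound by \<open>4 ^ m / sqrt (2 * m + 1)\<close>; the
  induction step then reduces to \<open>(2 * m + 1) * (2 * m + 3) \<le> 4 * (m + 1)\<^sup>2\<close>.
\<close>

lemma central_binomial_sq: "(2 * m choose m)\<^sup>2 * (2 * m + 1) \<le> 16 ^ m"
proof (induction m)
  case (Suc m)
  define C D where "C = (2 * m choose m)" and "D = (2 * Suc m choose Suc m)"
  have eq: "D * (m + 1) = C * (2 * (2 * m + 1))"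
  proof -
    have 1: "Suc m * (Suc (2*m+1) choose Suc m) = Suc (2*m+1) * (2*m+1 choose m)"
      using Suc_times_binomial[of m "2*m+1"] by simp
    have "Suc m * (2*m+1 choose Suc m) = (2*m+1) * C"
      using Suc_times_binomial[of m "2*m"] by (simp add: C_def)
    moreover have "(2*m+1 choose m) = (2*m+1 choose Suc m)"
      using binomial_symmetric[of m "2*m+1"] by simp
    ultimately have 2: "Suc m * (2*m+1 choose m) = (2*m+1) * C" by simp
    have "Suc m * D = Suc (2 * m + 1) * (2 * m + 1 choose m)"
      using 1 by (simp add: D_def)
    then have "Suc m * (D * (m+1)) = (2 * m + 2) * (Suc m * (2 * m + 1 choose m))"
      by (simp add: algebra_simps del: binomial_Suc_Suc)
    also have "\<dots> = Suc m * (C * (2 * (2 * m + 1)))"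
      unfolding 2 by (simp add: algebra_simps)
    finally have "Suc m * (D * (m+1)) = Suc m * (C * (2 * (2 * m + 1)))" .
    then show ?thesis by (metis mult_cancel1 nat.distinct(1))
  qed
  have "D\<^sup>2 * (2 * Suc m + 1) * (m+1)\<^sup>2 = (D * (m+1))\<^sup>2 * (2*m+3)"
    by (simp add: power2_eq_square algebra_simps)
  also have "\<dots> = (C\<^sup>2 * (2*m+1)) * (4 * ((2*m+1) * (2*m+3)))"
    unfolding eq by (simp add: power2_eq_square algebra_simps)
  also have "\<dots> \<le> 16 ^ m * (16 * (m+1)\<^sup>2)"
    by (rule mult_mono[OF Suc.IH[folded C_def]]) (simp_all add: power2_eq_square algebra_simps)
  finally have "D\<^sup>2 * (2 * Suc m + 1) * (m+1)\<^sup>2 \<le> 16 ^ Suc m * (m+1)\<^sup>2" by simp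
  moreover have "0 < (m + 1)\<^sup>2" by simp
  ultimately have "D\<^sup>2 * (2 * Suc m + 1) \<le> 16 ^ Suc m" by (simp only: mult_le_cancel2)
  then show ?case by (simp only: D_def)
qed simp

lemma central_binomial_le: "real (2 * m choose m) \<le> 4 ^ m / sqrt (2 * real m + 1)"
proof -
  have "(real (2 * m choose m) * sqrt (2 * real m + 1))\<^sup>2 = real ((2 * m choose m)\<^sup>2 * (2 * m + 1))"
    by (simp add: power_mult_distrib algebra_simps)
  also have "\<dots> \<le> real (16 ^ m)" using central_binomial_sq[of m] of_nat_le_iff by blast
  also have "\<dots> = (4 ^ m)\<^sup>2" by (simp add: power2_eq_square flip: power_mult_distrib)
  finally have "real (2 * m choose m) * sqrt (2 * real m + 1) \<le> 4 ^ m"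
    by (rule power2_le_imp_le) simp
  then show ?thesis by (simp add: field_simps)
qed

lemma middle_binomial_le: "real (t choose (t div 2)) \<le> 2 ^ t / sqrt (real t)" if "t > 0"
proof (cases "even t")
  case True
  then obtain m where m: "t = 2 * m" by blast
  have "real (t choose (t div 2)) \<le> 4 ^ m / sqrt (2 * real m + 1)"
    using central_binomial_le[of m] by (simp add: m)
  also have "\<dots> \<le> 4 ^ m / sqrt (real t)"
    using that m by (intro divide_left_mono) auto
  finally show ?thesis by (simp add: m power_mult)
next
  case False
  then obtain m where m: "t = Suc (2 * m)" by (metis oddE Suc_eq_plus1)
  have "(Suc (2 * m) choose m) \<le> 2 * (2 * m choose m)"
  proof (cases m)
    case (Suc k)
    have "(Suc (2 * m) choose m) = (2 * m choose k) + (2 * m choose m)" by (simp add: Suc)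
    also have "(2 * m choose k) \<le> (2 * m choose m)" using binomial_maximum[of "2*m" k] by simp
    finally show ?thesis by simp
  qed simp
  then have "real (t choose (t div 2)) \<le> 2 * real (2 * m choose m)"
    by (simp add: m)
  also have "\<dots> \<le> 2 * (4 ^ m / sqrt (2 * real m + 1))"
    using central_binomial_le[of m] by simp
  finally show ?thesis by (simp add: m power_mult add.commute)
qed

text \<open>
  No endpoint attracts more than a vanishing fraction of the \<open>2 ^ t\<close> walks. The constant \<open>M\<close> pays
  for the short walks; it makes the bound uniform in \<open>t\<close>, which is what the induction over the
  coordinates below requires.
\<close>

lemma walk_count_bound:
  assumes "\<epsilon> > 0"
  obtains M where "M \<ge> 0" and "\<And>t d. walk_count t d \<le> \<epsilon> * 2 ^ t + M"
proof -
  obtain t0 :: nat where t0: "t0 > 0" "1 / \<epsilon>\<^sup>2 < real t0"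
  proof -
    obtain t :: nat where "1 / \<epsilon>\<^sup>2 < real t" using reals_Archimedean2 by blast
    then show thesis using that[of "Suc t"] by simp
  qed
  have "walk_count t d \<le> \<epsilon> * 2 ^ t + 2 ^ t0" for t d
  proof (cases "t < t0")
    case True
    have "walk_count t d \<le> real (t choose (t div 2))" by (rule walk_count_le)
    also have "\<dots> \<le> 2 ^ t"
      using binomial_le_pow2[of t "t div 2"] by (metis of_nat_le_iff of_nat_numeral of_nat_power)
    also have "(2::real) ^ t \<le> 2 ^ t0" using True by (intro power_increasing) auto
    also have "\<dots> \<le> \<epsilon> * 2 ^ t + 2 ^ t0" using assms by simp
    finally show ?thesis .
  next
    case False
    then have t: "t > 0" "1 / \<epsilon>\<^sup>2 < real t" using t0 by auto
    have "1 / \<epsilon> \<le> sqrt (real t)"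
      using t by (intro real_le_rsqrt) (simp add: power_one_over)
    then have "1 / sqrt (real t) \<le> \<epsilon>" using assms t by (simp add: field_simps)
    then have "2 ^ t * (1 / sqrt (real t)) \<le> 2 ^ t * \<epsilon>" by (intro mult_left_mono) auto
    then have "2 ^ t / sqrt (real t) \<le> \<epsilon> * 2 ^ t" by (simp add: mult.commute)
    moreover have "(0::real) \<le> 2 ^ t0" by simp
    ultimately show ?thesis
      using walk_count_le[of t d] middle_binomial_le[OF t(1)] by linarith
  qed
  then show thesis using that[of "2 ^ t0"] by auto
qed

text \<open>
  A random letter moves the vote difference \<open>D\<close> by \<open>+1\<close> if it is \<open>a\<close>, by \<open>-1\<close> if it is \<open>b\<close>, and not
  at all in the \<open>p - 2\<close> other cases. Carrying \<open>t\<close> fair steps along turns this into a recursion: a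
  letter from \<open>{a, b}\<close> amounts to one more fair step, and every other letter drops out. The two parts
  of the bound \<open>\<epsilon> * 2 ^ t + M\<close> are both eigenfunctions of \<open>f \<mapsto> (\<lambda>t. f (t + 1) + (p - 2) * f t)\<close>, with
  eigenvalues \<open>p\<close> and \<open>p - 1\<close>, so the second becomes negligible for long words.
\<close>

lemma sum_walk_count_words:
  assumes "finite I" and "a \<in> {0..<int p}" "b \<in> {0..<int p}" "a \<noteq> b"
    and bound: "\<And>t d. walk_count t d \<le> \<epsilon> * 2 ^ t + M"
  shows "(\<Sum>x\<in>words p I. walk_count t (d - (int (votes p I x a) - int (votes p I x b))))
    \<le> \<epsilon> * 2 ^ t * real p ^ card I + M * (real p - 1) ^ card I"
  using assms(1)
proof (induction I arbitrary: t rule: finite_induct)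
  case empty
  then show ?case using bound by (simp add: votes_def)
next
  case (insert i I)
  let ?D = "\<lambda>x. d - (int (votes p I x a) - int (votes p I x b))"
  have p: "real p \<ge> 2" using assms(2-4) by auto
  have ab: "a mod int p = a" "b mod int p = b" using assms(2,3) by auto
  have inner: "(\<Sum>v\<in>{0..<int p}. walk_count t (d - (int (votes p (insert i I) (x(i := v)) a)
        - int (votes p (insert i I) (x(i := v)) b))))
      = walk_count (Suc t) (?D x) + (real p - 2) * walk_count t (?D x)" (is "(\<Sum>v\<in>_. ?f v) = _") for x
  proof -
    have "(\<Sum>v\<in>{0..<int p}. ?f v) = ?f a + (?f b + (\<Sum>v\<in>{0..<int p} - {a} - {b}. ?f v))"
      using assms(2-4) sum.remove[of "{0..<int p}" a ?f] sum.remove[of "{0..<int p} - {a}" b ?f] by simp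
    also have "(\<Sum>v\<in>{0..<int p} - {a} - {b}. ?f v)
        = (\<Sum>v\<in>{0..<int p} - {a} - {b}. walk_count t (?D x))"
      by (intro sum.cong) (auto simp: votes_insert[OF insert.hyps] ab)
    also have "\<dots> = (real p - 2) * walk_count t (?D x)"
      using assms(2-4) p by (simp add: card_Diff_singleton of_nat_diff)
    also have "?f a = walk_count t (?D x - 1)"
      using assms(4) by (simp add: votes_insert[OF insert.hyps] ab algebra_simps)
    also have "?f b = walk_count t (?D x + 1)"
      using assms(4) by (simp add: votes_insert[OF insert.hyps] ab algebra_simps)
    finally show ?thesis by (simp only: walk_count_Suc add.assoc)
  qed
  have "(\<Sum>x\<in>words p (insert i I). walk_count t (d - (int (votes p (insert i I) x a)
        - int (votes p (insert i I) x b))))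
      = (\<Sum>x\<in>words p I. walk_count (Suc t) (?D x)) + (real p - 2) * (\<Sum>x\<in>words p I. walk_count t (?D x))"
    by (simp only: sum_words_insert[OF insert.hyps(2)] inner sum.distrib sum_distrib_left)
  also have "\<dots> \<le> (\<epsilon> * 2 ^ Suc t * real p ^ card I + M * (real p - 1) ^ card I)
      + (real p - 2) * (\<epsilon> * 2 ^ t * real p ^ card I + M * (real p - 1) ^ card I)"
    using p by (intro add_mono mult_left_mono insert.IH) auto
  also have "\<dots> = \<epsilon> * 2 ^ t * real p ^ card (insert i I) + M * (real p - 1) ^ card (insert i I)"
    using insert.hyps by (simp add: algebra_simps)
  finally show ?case .
qed

lemma card_vote_difference_le:
  assumes "finite I" and "a \<in> {0..<int p}" "b \<in> {0..<int p}" "a \<noteq> b"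
    and bound: "\<And>t d. walk_count t d \<le> \<epsilon> * 2 ^ t + M"
  shows "real (card {x \<in> words p I. int (votes p I x a) - int (votes p I x b) = d})
    \<le> \<epsilon> * real p ^ card I + M * (real p - 1) ^ card I"
proof -
  have "real (card {x \<in> words p I. int (votes p I x a) - int (votes p I x b) = d})
      = (\<Sum>x\<in>words p I. if int (votes p I x a) - int (votes p I x b) = d then 1 else 0)"
    using finite_words[OF assms(1)] by (simp add: sum.If_cases Int_def)
  also have "\<dots> = (\<Sum>x\<in>words p I. walk_count 0 (d - (int (votes p I x a) - int (votes p I x b))))"
    by (intro sum.cong refl) (auto simp: walk_count_0)
  also have "\<dots> \<le> \<epsilon> * 2 ^ 0 * real p ^ card I + M * (real p - 1) ^ card I"
    by (rule sum_walk_count_words[OF assms])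
  finally show ?thesis by simp
qed

lemma votes_mod [simp]: "votes p I x (a mod int p) = votes p I x a"
  by (simp add: votes_def)

section \<open>Most words have a clear winner\<close>

lemma no_winner_imp_close_pair:
  assumes "p > 0" and "\<nexists>a. wins p I K x a"
  obtains a b where "a \<in> {0..<int p}" "b \<in> {0..<int p}" "a \<noteq> b"
    and "\<bar>int (votes p I x a) - int (votes p I x b)\<bar> \<le> int K"
proof -
  have fin: "finite (votes p I x ` {0..<int p})" "votes p I x ` {0..<int p} \<noteq> {}"
    using assms(1) by auto
  then obtain a where a: "a \<in> {0..<int p}" "votes p I x a = Max (votes p I x ` {0..<int p})"
    by (metis (mono_tags, lifting) Max_in imageE)
  obtain b where b: "b mod int p \<noteq> a mod int p" "votes p I x a \<le> votes p I x b + K"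
    using assms(2) unfolding wins_def by (metis not_less)
  have "b mod int p \<in> {0..<int p}" using assms(1) by auto
  moreover have "votes p I x (b mod int p) \<le> votes p I x a"
    using a(2) fin(1) calculation by (metis Max_ge image_eqI)
  ultimately show thesis using that[of a "b mod int p"] a(1) b by auto
qed

lemma card_no_winner_le:
  assumes "finite I" "p > 0" "\<epsilon> \<ge> 0" "M \<ge> 0"
    and bound: "\<And>t d. walk_count t d \<le> \<epsilon> * 2 ^ t + M"
  shows "real (card {x \<in> words p I. \<nexists>a. wins p I K x a})
    \<le> real (p\<^sup>2 * (2 * K + 1)) * (\<epsilon> * real p ^ card I + M * (real p - 1) ^ card I)"
proof -
  define T where "T = {(a, b, d). a \<in> {0..<int p} \<and> b \<in> {0..<int p} \<and> a \<noteq> b \<and> d \<in> {-int K..int K}}"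
  define E where "E = (\<lambda>(a, b, d). {x \<in> words p I. int (votes p I x a) - int (votes p I x b) = d})"
  have sub: "T \<subseteq> {0..<int p} \<times> {0..<int p} \<times> {-int K..int K}" by (auto simp: T_def)
  then have fT: "finite T" by (rule finite_subset) simp
  have "card T \<le> card ({0..<int p} \<times> {0..<int p} \<times> {-int K..int K})"
    by (rule card_mono[OF _ sub]) simp
  also have "\<dots> = p\<^sup>2 * (2 * K + 1)"
    by (simp add: card_cartesian_product power2_eq_square algebra_simps nat_add_distrib nat_mult_distrib)
  finally have cT: "card T \<le> p\<^sup>2 * (2 * K + 1)" .
  have "{x \<in> words p I. \<nexists>a. wins p I K x a} \<subseteq> (\<Union>s\<in>T. E s)"
  proof
    fix x assume x: "x \<in> {x \<in> words p I. \<nexists>a. wins p I K x a}"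
    then obtain a b where "a \<in> {0..<int p}" "b \<in> {0..<int p}" "a \<noteq> b"
      and "\<bar>int (votes p I x a) - int (votes p I x b)\<bar> \<le> int K"
      using no_winner_imp_close_pair[OF assms(2)] by blast
    then have "(a, b, int (votes p I x a) - int (votes p I x b)) \<in> T" by (auto simp: T_def)
    moreover have "x \<in> E (a, b, int (votes p I x a) - int (votes p I x b))"
      using x by (simp add: E_def)
    ultimately show "x \<in> (\<Union>s\<in>T. E s)" by blast
  qed
  then have "card {x \<in> words p I. \<nexists>a. wins p I K x a} \<le> card (\<Union>s\<in>T. E s)"
    using fT finite_words[OF assms(1)] by (intro card_mono) (auto simp: E_def)
  also have "\<dots> \<le> (\<Sum>s\<in>T. card (E s))" by (rule card_UN_le[OF fT])
  finally have "real (card {x \<in> words p I. \<nexists>a. wins p I K x a}) \<le> real (\<Sum>s\<in>T. card (E s))"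
    by (simp only: of_nat_le_iff)
  also have "\<dots> = (\<Sum>s\<in>T. real (card (E s)))" by simp
  also have "\<dots> \<le> (\<Sum>s\<in>T. \<epsilon> * real p ^ card I + M * (real p - 1) ^ card I)"
  proof (rule sum_mono)
    fix s assume "s \<in> T"
    then show "real (card (E s)) \<le> \<epsilon> * real p ^ card I + M * (real p - 1) ^ card I"
      using card_vote_difference_le[OF assms(1) _ _ _ bound] by (auto simp: T_def E_def)
  qed
  also have "\<dots> = real (card T) * (\<epsilon> * real p ^ card I + M * (real p - 1) ^ card I)" by simp
  also have "\<dots> \<le> real (p\<^sup>2 * (2 * K + 1)) * (\<epsilon> * real p ^ card I + M * (real p - 1) ^ card I)"
  proof (rule mult_right_mono)
    show "real (card T) \<le> real (p\<^sup>2 * (2 * K + 1))" using cT of_nat_le_iff by blast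
    show "0 \<le> \<epsilon> * real p ^ card I + M * (real p - 1) ^ card I"
      using assms(2-4) by simp
  qed
  finally show ?thesis .
qed

lemma eventually_few_without_winner:
  assumes "p > 0" "\<delta> > 0"
  shows "\<forall>\<^sub>F n in sequentially. \<forall>I. finite I \<and> card I = n \<longrightarrow>
    real (card {x \<in> words p I. \<nexists>a. wins p I K x a}) \<le> \<delta> * real p ^ n"
proof -
  define C where "C = real (p\<^sup>2 * (2 * K + 1))"
  have C: "C > 0" unfolding C_def of_nat_0_less_iff using assms(1) by simp
  define \<epsilon> where "\<epsilon> = \<delta> / (2 * C)"
  have "\<epsilon> > 0" using assms C by (simp add: \<epsilon>_def)
  then obtain M where M: "M \<ge> 0" "\<And>t d. walk_count t d \<le> \<epsilon> * 2 ^ t + M"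
    using walk_count_bound by blast
  have "(\<lambda>n. C * M * ((real p - 1) / real p) ^ n) \<longlonglongrightarrow> C * M * 0"
    using assms(1) by (intro tendsto_mult tendsto_const LIMSEQ_power_zero) (auto simp: field_simps)
  then have "\<forall>\<^sub>F n in sequentially. C * M * ((real p - 1) / real p) ^ n < \<delta> / 2"
    using assms(2) by (intro order_tendstoD(2)) auto
  then show ?thesis
  proof (eventually_elim, intro allI impI)
    fix n and I :: "nat set"
    assume n: "C * M * ((real p - 1) / real p) ^ n < \<delta> / 2" and I: "finite I \<and> card I = n"
    have "real (card {x \<in> words p I. \<nexists>a. wins p I K x a})
        \<le> C * (\<epsilon> * real p ^ n + M * (real p - 1) ^ n)"
      using card_no_winner_le[OF _ assms(1) _ M, of I K] I \<open>\<epsilon> > 0\<close> by (simp add: C_def)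
    also have "\<dots> = (\<delta> / 2 + C * M * ((real p - 1) / real p) ^ n) * real p ^ n"
      using C assms(1) by (simp add: \<epsilon>_def power_divide field_simps)
    also have "\<dots> \<le> \<delta> * real p ^ n"
      using n by (intro mult_right_mono) auto
    finally show "real (card {x \<in> words p I. \<nexists>a. wins p I K x a}) \<le> \<delta> * real p ^ n" .
  qed
qed

lemma votes_cong:
  assumes "\<And>i. i \<in> I \<Longrightarrow> x i mod int p = y i mod int p"
  shows "votes p I x a = votes p I y a"
  unfolding votes_def using assms by (metis (mono_tags, lifting))

lemma wins_cong:
  assumes "\<And>i. i \<in> I \<Longrightarrow> x i mod int p = y i mod int p"
  shows "wins p I K x a \<longleftrightarrow> wins p I K y a"
  using votes_cong[OF assms] by (simp add: wins_def)

lemma winner_unique: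
  assumes "wins p I K x a" "wins p I L x b"
  shows "a mod int p = b mod int p"
  using assms unfolding wins_def by (metis add_lessD1 less_asym)

text \<open>
  Altering \<open>K\<close> coordinates changes each vote count by at most \<open>K\<close>, hence each margin by at most
  \<open>2 * K\<close>.
\<close>

lemma wins_translate_one:
  assumes "finite I" "wins p I (2 * K) x a"
    and few: "card {i \<in> I. y i mod int p \<noteq> (x i + 1) mod int p} \<le> K"
  shows "wins p I 0 y (a + 1)"
  unfolding wins_def
proof (intro allI impI)
  fix b assume b: "b mod int p \<noteq> (a + 1) mod int p"
  let ?E = "{i \<in> I. y i mod int p \<noteq> (x i + 1) mod int p}"
  have eq: "u mod int p = v mod int p \<longleftrightarrow> (u + 1) mod int p = (v + 1) mod int p" for u v
    using mod_add_cong[of u "int p" v 1 1] mod_diff_cong[of "u + 1" "int p" "v + 1" 1 1] by auto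
  have "{i \<in> I. x i mod int p = a mod int p} \<subseteq> {i \<in> I. y i mod int p = (a + 1) mod int p} \<union> ?E"
    using eq by auto
  then have "votes p I x a \<le> card ({i \<in> I. y i mod int p = (a + 1) mod int p} \<union> ?E)"
    unfolding votes_def using assms(1) by (intro card_mono) auto
  also have "\<dots> \<le> votes p I y (a + 1) + K"
    using few card_Un_le[of "{i \<in> I. y i mod int p = (a + 1) mod int p}" ?E] by (simp add: votes_def)
  finally have 1: "votes p I x a \<le> votes p I y (a + 1) + K" .
  have "{i \<in> I. y i mod int p = b mod int p} \<subseteq> {i \<in> I. x i mod int p = (b - 1) mod int p} \<union> ?E"
  proof
    fix i assume i: "i \<in> {i \<in> I. y i mod int p = b mod int p}"
    then show "i \<in> {i \<in> I. x i mod int p = (b - 1) mod int p} \<union> ?E"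
      using eq[of "x i" "b - 1"] by (cases "(x i + 1) mod int p = b mod int p") auto
  qed
  then have "votes p I y b \<le> card ({i \<in> I. x i mod int p = (b - 1) mod int p} \<union> ?E)"
    unfolding votes_def using assms(1) by (intro card_mono) auto
  also have "\<dots> \<le> votes p I x (b - 1) + K"
    using few card_Un_le[of "{i \<in> I. x i mod int p = (b - 1) mod int p}" ?E] by (simp add: votes_def)
  finally have 2: "votes p I y b \<le> votes p I x (b - 1) + K" .
  have "(b - 1) mod int p \<noteq> a mod int p" using b eq[of "b - 1" a] by simp
  then have "votes p I x (b - 1) + 2 * K < votes p I x a" using assms(2) by (simp add: wins_def)
  with 1 2 show "votes p I y b + 0 < votes p I y (a + 1)" by simp
qed

section \<open>The tower of translated fibres\<close>

text \<open>
  Block \<open>j\<close> consists of the coordinates from \<open>N j\<close> to \<open>N (Suc j) - 1\<close>; coordinate \<open>0\<close> precedes all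
  blocks. A block longer than \<open>2 * j\<close> guarantees that the zero word on it is won by \<open>0\<close> with the
  required margin.
\<close>

locale block_tower =
  fixes p :: nat and N :: "nat \<Rightarrow> nat" and h :: "nat \<Rightarrow> nat \<Rightarrow> int"
  assumes two_le_p: "2 \<le> p"
    and N_0: "N 0 = 1"
    and N_Suc: "N j + 2 * j < N (Suc j)"
    and h_eq_0: "N j \<le> i \<Longrightarrow> h j i = 0"
begin

definition block :: "nat \<Rightarrow> nat set" where
  "block j = {N j..<N (Suc j)}"

definition half :: "nat \<Rightarrow> int" where
  "half i = (if i = 0 then int (p div 2) else 0)"

text \<open>
  Membership of \<open>x\<close> in \<open>level j\<close> depends only on the coordinates below \<open>N j\<close>, modulo \<open>p\<close>. The levels
  are sets of arbitrary integer vectors; \<open>tower\<close> cuts them down to group elements.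
\<close>

primrec level :: "nat \<Rightarrow> (nat \<Rightarrow> int) set" where
  "level 0 = {x. x 0 mod int p < int (p div 2)}"
| "level (Suc j) = {x. \<exists>a. wins p (block j) (2 * j) x a \<and>
      (\<lambda>i. x i - a * (h j i + half i)) \<in> level j}"

definition tower :: "(nat \<Rightarrow> int) set" where
  "tower = {x. \<exists>j. x \<in> words p {..<N j} \<and> x \<in> level j}"

lemma strict_mono_N: "strict_mono N"
  using N_Suc by (intro strict_monoI_Suc) (metis add_lessD1)

lemma N_mono: "i \<le> j \<Longrightarrow> N i \<le> N j"
  using strict_mono_N by (simp add: strict_mono_less_eq)

lemma le_N: "j \<le> N j"
  using strict_mono_N by (rule strict_mono_imp_increasing)

lemma finite_block [simp]: "finite (block j)"
  by (simp add: block_def)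

lemma level_cong:
  assumes "x \<in> level j" "\<And>i. i < N j \<Longrightarrow> x i mod int p = y i mod int p"
  shows "y \<in> level j"
  using assms
proof (induction j arbitrary: x y)
  case 0
  then show ?case using N_0 by simp
next
  case (Suc j)
  then obtain a where a: "wins p (block j) (2 * j) x a"
    "(\<lambda>i. x i - a * (h j i + half i)) \<in> level j" by auto
  have "wins p (block j) (2 * j) y a"
    using a(1) Suc.prems(2) wins_cong[of "block j" x p y] by (auto simp: block_def)
  moreover have "(\<lambda>i. y i - a * (h j i + half i)) \<in> level j"
    by (rule Suc.IH[OF a(2)]) (use Suc.prems(2) N_mono[of j "Suc j"] in \<open>auto intro!: mod_diff_cong\<close>)
  ultimately show ?case by auto
qed

text \<open>
  A difference \<open>s\<close> supported below \<open>N i\<close> does not affect the votes in blocks \<open>i\<close> and above. Hence \<open>x\<close>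
  and \<open>x + s\<close> are translated by the same vectors there, and undoing these translations preserves
  their difference.
\<close>

lemma descend:
  assumes "i \<le> j" "x \<in> level j" "(\<lambda>l. x l + s l) \<in> level j" "\<And>l. N i \<le> l \<Longrightarrow> s l = 0"
  shows "\<exists>x'. x' \<in> level i \<and> (\<lambda>l. x' l + s l) \<in> level i"
  using assms(1-3)
proof (induction j arbitrary: x rule: dec_induct)
  case base
  then show ?case by blast
next
  case (step j)
  obtain a where a: "wins p (block j) (2 * j) x a"
    "(\<lambda>l. x l - a * (h j l + half l)) \<in> level j" using step.prems(1) by auto
  obtain b where b: "wins p (block j) (2 * j) (\<lambda>l. x l + s l) b"
    "(\<lambda>l. x l + s l - b * (h j l + half l)) \<in> level j" using step.prems(2) by auto
  have "wins p (block j) (2 * j) (\<lambda>l. x l + s l) b \<longleftrightarrow> wins p (block j) (2 * j) x b"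
    using N_mono[OF step.hyps(1)] assms(4) by (intro wins_cong) (auto simp: block_def)
  with a b have ab: "b mod int p = a mod int p" using winner_unique by blast
  have "(\<lambda>l. x l - a * (h j l + half l) + s l) \<in> level j"
  proof (rule level_cong[OF b(2)])
    fix l
    have "(x l + s l - b * (h j l + half l)) mod int p = (x l + s l - a * (h j l + half l)) mod int p"
      using ab by (intro mod_diff_cong mod_mult_cong) auto
    then show "(x l + s l - b * (h j l + half l)) mod int p
        = (x l - a * (h j l + half l) + s l) mod int p" by (simp add: algebra_simps)
  qed
  with a(2) show ?case using step.IH by blast
qed

text \<open>
  By descent to level \<open>0\<close>, where coordinate \<open>0\<close> would have to lie in both \<open>{0..<p div 2}\<close> and its
  translate by \<open>p div 2\<close>. These are disjoint modulo \<open>p\<close> since \<open>2 * (p div 2) \<le> p\<close>.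
\<close>

lemma half_not_difference:
  assumes "x \<in> level j"
  shows "(\<lambda>l. x l + half l) \<notin> level j"
proof
  assume "(\<lambda>l. x l + half l) \<in> level j"
  then obtain y where y: "y \<in> level 0" "(\<lambda>l. y l + half l) \<in> level 0"
    using descend[of 0 j x half] assms by (auto simp: half_def N_0)
  define r where "r = y 0 mod int p"
  have r: "0 \<le> r" "r < int (p div 2)" using y(1) two_le_p by (auto simp: r_def)
  have "(y 0 + int (p div 2)) mod int p = (r + int (p div 2)) mod int p"
    by (simp add: r_def mod_add_left_eq)
  also have "\<dots> = r + int (p div 2)" using r by (intro mod_pos_pos_trivial) auto
  finally show False using y(2) r by (simp add: half_def)
qed

text \<open>
  The heart of the construction. After descent to level \<open>Suc j\<close>, the winners of \<open>y\<close> and \<open>y + s\<close> on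
  block \<open>j\<close> are \<open>a\<close> and \<open>a + 1\<close>. Below \<open>N j\<close>, removing the translations \<open>a * (h j + half)\<close> and
  \<open>(a + 1) * (h j + half)\<close> leaves the difference \<open>h j - (h j + half) = - half\<close>, which is excluded.
\<close>

lemma sparse_not_difference:
  assumes low: "\<And>i. i < N j \<Longrightarrow> s i = h j i"
    and high: "\<And>i. N (Suc j) \<le> i \<Longrightarrow> s i = 0"
    and ones: "card {i \<in> block j. s i \<noteq> 1} \<le> j"
    and "Suc j \<le> J" "x \<in> level J"
  shows "(\<lambda>i. x i + s i) \<notin> level J"
proof
  assume "(\<lambda>i. x i + s i) \<in> level J"
  then obtain y where y: "y \<in> level (Suc j)" "(\<lambda>i. y i + s i) \<in> level (Suc j)"
    using descend[where i = "Suc j" and j = J and x = x and s = s] assms(4,5) high by blast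
  from y(1) obtain a where a: "wins p (block j) (2 * j) y a"
    "(\<lambda>i. y i - a * (h j i + half i)) \<in> level j" by auto
  from y(2) obtain b where b: "wins p (block j) (2 * j) (\<lambda>i. y i + s i) b"
    "(\<lambda>i. y i + s i - b * (h j i + half i)) \<in> level j" by auto
  have "card {i \<in> block j. (y i + s i) mod int p \<noteq> (y i + 1) mod int p}
      \<le> card {i \<in> block j. s i \<noteq> 1}"
    by (intro card_mono) auto
  with ones have "wins p (block j) 0 (\<lambda>i. y i + s i) (a + 1)"
    using wins_translate_one[OF _ a(1)] by simp
  with b(1) have ab: "b mod int p = (a + 1) mod int p" using winner_unique by blast
  let ?z = "\<lambda>i. y i - a * (h j i + half i) - half i"
  have "?z \<in> level j"
  proof (rule level_cong[OF b(2)])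
    fix i assume "i < N j"
    have "(y i + s i - b * (h j i + half i)) mod int p
        = (y i + s i - (a + 1) * (h j i + half i)) mod int p"
      using ab by (intro mod_diff_cong mod_mult_cong) auto
    then show "(y i + s i - b * (h j i + half i)) mod int p = ?z i mod int p"
      using low[OF \<open>i < N j\<close>] by (simp add: algebra_simps)
  qed
  from half_not_difference[OF this] a(2) show False by simp
qed

text \<open>
  On block \<open>j\<close> the vector is zero, so the winner is \<open>0\<close> and the fibre is not translated.
\<close>

lemma level_Suc_of_level:
  assumes "x \<in> words p {..<N j}" "x \<in> level j"
  shows "x \<in> level (Suc j)"
proof -
  have x: "x i = 0" if "i \<in> block j" for i
    using assms(1) that by (auto simp: words_def block_def)
  have "votes p (block j) x 0 = card (block j)"
    unfolding votes_def by (rule arg_cong[of _ _ card]) (auto simp: x)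
  moreover have "votes p (block j) x b = 0" if "b mod int p \<noteq> 0 mod int p" for b
    using that x unfolding votes_def by (auto simp: card_eq_0_iff)
  ultimately have "wins p (block j) (2 * j) x 0"
    using N_Suc[of j] by (auto simp: wins_def block_def)
  then show ?thesis using assms(2) by (auto intro!: exI[of _ 0])
qed

lemma words_mono: "I \<subseteq> J \<Longrightarrow> words p I \<subseteq> words p J"
  using two_le_p by (fastforce simp: words_def)

lemma level_of_level:
  assumes "j \<le> J" "x \<in> words p {..<N j}" "x \<in> level j"
  shows "x \<in> level J"
  using assms(1)
proof (induction J rule: dec_induct)
  case (step J)
  have "x \<in> words p {..<N J}"
    using assms(2) words_mono[of "{..<N j}" "{..<N J}"] N_mono[OF step.hyps(1)] by auto
  then show ?case using level_Suc_of_level step.IH by blast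
qed (rule assms(3))

lemma tower_avoids:
  assumes low: "\<And>i. i < N j \<Longrightarrow> s i = h j i"
    and high: "\<And>i. N (Suc j) \<le> i \<Longrightarrow> s i = 0"
    and ones: "card {i \<in> block j. s i \<noteq> 1} \<le> j"
    and "x \<in> tower" "y \<in> tower"
  shows "\<exists>i. y i mod int p \<noteq> (x i + s i) mod int p"
proof (rule ccontr)
  assume "\<not> ?thesis"
  then have eq: "y i mod int p = (x i + s i) mod int p" for i by blast
  obtain k where k: "x \<in> words p {..<N k}" "x \<in> level k" using assms(4) by (auto simp: tower_def)
  obtain l where l: "y \<in> words p {..<N l}" "y \<in> level l" using assms(5) by (auto simp: tower_def)
  define J where "J = max (Suc j) (max k l)"
  have "x \<in> level J" using level_of_level[OF _ k] by (simp add: J_def)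
  moreover have "y \<in> level J" using level_of_level[OF _ l] by (simp add: J_def)
  then have "(\<lambda>i. x i + s i) \<in> level J" by (rule level_cong) (simp add: eq)
  ultimately show False
    using sparse_not_difference[OF low high ones, of J x] by (simp add: J_def)
qed

text \<open>
  Over each word with a clear winner, the fibre of the new level is a translate of the old level.
\<close>

lemma card_level_Suc_ge:
  "card (level j \<inter> words p {..<N j}) * card {z \<in> words p (block j). \<exists>a. wins p (block j) (2 * j) z a}
     \<le> card (level (Suc j) \<inter> words p {..<N (Suc j)})"
proof -
  let ?Y = "level j \<inter> words p {..<N j}"
  let ?Z = "{z \<in> words p (block j). \<exists>a. wins p (block j) (2 * j) z a}"
  have "\<exists>w. \<forall>z\<in>?Z. wins p (block j) (2 * j) z (w z)" by (rule bchoice) auto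
  then obtain w where w: "z \<in> ?Z \<Longrightarrow> wins p (block j) (2 * j) z (w z)" for z by blast
  \<comment> \<open>On the block \<open>F (y, z)\<close> is \<open>z\<close>, which determines the translation applied to \<open>y\<close>; so \<open>F\<close> is injective.\<close>
  define F where "F = (\<lambda>(y, z). \<lambda>i. if i < N j then (y i + w z * (h j i + half i)) mod int p else z i)"
  have "inj_on F (?Y \<times> ?Z)"
  proof (rule inj_onI, clarsimp)
    fix y z y' z'
    assume y: "y \<in> words p {..<N j}" "y' \<in> words p {..<N j}"
      and z: "z \<in> words p (block j)" "z' \<in> words p (block j)" and eq: "F (y, z) = F (y', z')"
    have "z i = z' i" for i
    proof (cases "i < N j")
      case True
      then show ?thesis using z by (auto simp: words_def block_def)
    next
      case False
      then show ?thesis using fun_cong[OF eq, of i] by (simp add: F_def)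
    qed
    then have zz: "z = z'" by auto
    have "y i = y' i" for i
    proof (cases "i < N j")
      case True
      then have "(y i + w z * (h j i + half i)) mod int p = (y' i + w z * (h j i + half i)) mod int p"
        using fun_cong[OF eq, of i] by (simp add: F_def zz)
      then have "(y i + w z * (h j i + half i) - w z * (h j i + half i)) mod int p
          = (y' i + w z * (h j i + half i) - w z * (h j i + half i)) mod int p"
        by (rule mod_diff_cong) simp
      then have "y i mod int p = y' i mod int p" by simp
      then show ?thesis using y True by (simp add: words_def)
    next
      case False
      then show ?thesis using y by (auto simp: words_def)
    qed
    then show "y = y' \<and> z = z'" using zz by auto
  qed
  moreover have "F ` (?Y \<times> ?Z) \<subseteq> level (Suc j) \<inter> words p {..<N (Suc j)}"
  proof (rule image_subsetI)
    fix q assume "q \<in> ?Y \<times> ?Z"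
    then obtain y z where q: "q = (y, z)" and y: "y \<in> level j" "y \<in> words p {..<N j}" and z: "z \<in> ?Z"
      by auto
    have "F (y, z) i = z i" if "i \<in> block j" for i using that by (simp add: F_def block_def)
    then have "wins p (block j) (2 * j) (F (y, z)) (w z)"
      using w[OF z] wins_cong[of "block j" z p "F (y, z)"] by simp
    moreover have "(\<lambda>i. F (y, z) i - w z * (h j i + half i)) \<in> level j"
      by (rule level_cong[OF y(1)]) (simp add: F_def mod_diff_left_eq)
    moreover have "F (y, z) \<in> words p {..<N (Suc j)}"
      using z two_le_p N_mono[of j "Suc j"] by (auto simp: F_def words_def block_def)
    ultimately show "F q \<in> level (Suc j) \<inter> words p {..<N (Suc j)}" by (auto simp: q)
  qed
  ultimately have "card (?Y \<times> ?Z) \<le> card (level (Suc j) \<inter> words p {..<N (Suc j)})"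
    by (intro card_inj_on_le[of F]) (auto intro: finite_words)
  then show ?thesis by (simp add: card_cartesian_product)
qed

definition level_density :: "nat \<Rightarrow> real" where
  "level_density j = real (card (level j \<inter> words p {..<N j})) / real p ^ N j"

lemma level_density_0: "level_density 0 \<ge> 1 / 2 - 1 / (2 * real p)"
proof -
  have "(\<lambda>v. (\<lambda>_. 0)(0 := v)) ` {0..<int (p div 2)} \<subseteq> level 0 \<inter> words p {..<N 0}"
  proof (rule image_subsetI)
    fix v :: int assume "v \<in> {0..<int (p div 2)}"
    then have v: "0 \<le> v" "v < int (p div 2)" by auto
    moreover have "int (p div 2) \<le> int p" by simp
    ultimately have "v < int p" by linarith
    with v show "(\<lambda>_. 0)(0 := v) \<in> level 0 \<inter> words p {..<N 0}"
      by (simp add: words_def N_0)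
  qed
  then have "card ((\<lambda>v. (\<lambda>_::nat. 0)(0 := v)) ` {0..<int (p div 2)}) \<le> card (level 0 \<inter> words p {..<N 0})"
    by (intro card_mono) (auto intro: finite_words)
  moreover have "inj_on (\<lambda>v. (\<lambda>_::nat. 0::int)(0 := v)) {0..<int (p div 2)}"
    by (rule inj_onI) (metis fun_upd_same)
  ultimately have "p div 2 \<le> card (level 0 \<inter> words p {..<N 0})"
    by (simp add: card_image)
  moreover have "p \<le> 2 * (p div 2) + 1" by simp
  ultimately have "real p - 1 \<le> 2 * real (card (level 0 \<inter> words p {..<N 0}))" by linarith
  then have "(real p - 1) / (2 * real p) \<le> 2 * real (card (level 0 \<inter> words p {..<N 0})) / (2 * real p)"
    by (intro divide_right_mono) auto
  then show ?thesis using two_le_p by (simp add: level_density_def N_0 diff_divide_distrib)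
qed

lemma level_density_Suc:
  assumes "real (card {z \<in> words p (block j). \<nexists>a. wins p (block j) (2 * j) z a})
    \<le> \<delta> * real p ^ card (block j)"
  shows "level_density (Suc j) \<ge> level_density j - \<delta>"
proof -
  let ?B = "real p ^ card (block j)"
  let ?Y = "real (card (level j \<inter> words p {..<N j}))"
  let ?Z = "{z \<in> words p (block j). \<exists>a. wins p (block j) (2 * j) z a}"
  let ?Z' = "{z \<in> words p (block j). \<nexists>a. wins p (block j) (2 * j) z a}"
  have pos: "real p > 0" "?B > 0" using two_le_p by auto
  have "card (words p (block j)) = card ?Z + card ?Z'"
    using finite_words[of "block j" p]
    by (subst card_Un_disjoint[symmetric]) (auto intro!: arg_cong[of _ _ card])
  then have "?B = real (card ?Z + card ?Z')"
    by (simp only: card_words[OF finite_block] flip: of_nat_power)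
  then have "?B = real (card ?Z) + real (card ?Z')" by simp
  with assms have Z: "(1 - \<delta>) * ?B \<le> real (card ?Z)" by (simp add: algebra_simps)
  have NS: "real p ^ N (Suc j) = real p ^ N j * ?B"
    using N_mono[of j "Suc j"] by (simp add: block_def flip: power_add)
  have le1: "level_density j \<le> 1"
  proof -
    have "card (level j \<inter> words p {..<N j}) \<le> card (words p {..<N j})"
      by (intro card_mono) (auto intro: finite_words)
    then have "card (level j \<inter> words p {..<N j}) \<le> p ^ N j" by (simp add: card_words)
    then have "?Y \<le> real p ^ N j" by (simp only: of_nat_le_iff flip: of_nat_power)
    then show ?thesis using pos by (simp add: level_density_def)
  qed
  have "0 \<le> real (card ?Z')" by simp
  with assms have "0 \<le> \<delta> * ?B" by linarith
  then have \<delta>: "0 \<le> \<delta>" using pos(2) by (simp add: zero_le_mult_iff)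
  have "level_density j - \<delta> \<le> level_density j * (1 - \<delta>)"
    using mult_right_mono[OF le1 \<delta>] by (simp add: algebra_simps)
  also have "\<dots> = ?Y * ((1 - \<delta>) * ?B) / real p ^ N (Suc j)"
    using pos by (simp add: level_density_def NS)
  also have "\<dots> \<le> ?Y * real (card ?Z) / real p ^ N (Suc j)"
    using Z by (intro divide_right_mono mult_left_mono) auto
  also have "\<dots> \<le> level_density (Suc j)"
    unfolding level_density_def of_nat_mult[symmetric]
    using card_level_Suc_ge[of j] by (intro divide_right_mono) (auto simp only: of_nat_le_iff zero_le_power of_nat_0_le_iff)
  finally show ?thesis .
qed

lemma tower_density:
  "real (card (tower \<inter> words p {..<N j})) / real (card (words p {..<N j})) \<ge> level_density j"
proof -
  have "card (level j \<inter> words p {..<N j}) \<le> card (tower \<inter> words p {..<N j})"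
    by (intro card_mono) (auto simp: tower_def intro: finite_words)
  then show ?thesis
    by (simp add: level_density_def card_words divide_right_mono)
qed

end

section \<open>The group and its Folner sequence of initial segments\<close>

lemma carrier_Fp_omega_eq_words:
  assumes "p > 0"
  shows "carrier (Fp_omega p) = (\<Union>n. words p {..<n})"
proof
  show "carrier (Fp_omega p) \<subseteq> (\<Union>n. words p {..<n})"
  proof
    fix x assume x: "x \<in> carrier (Fp_omega p)"
    then have "finite {i. x i \<noteq> 0}" using assms by (simp add: carrier_Fp_omega)
    then obtain n where "\<forall>i\<in>{i. x i \<noteq> 0}. i < n" by (auto simp: finite_nat_set_iff_bounded)
    then have "x \<in> words p {..<n}" using x assms by (auto simp: carrier_Fp_omega words_def)
    then show "x \<in> (\<Union>n. words p {..<n})" by blast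
  qed
  show "(\<Union>n. words p {..<n}) \<subseteq> carrier (Fp_omega p)"
  proof (clarify)
    fix x n assume x: "x \<in> words p {..<n}"
    then have "{i. x i \<noteq> 0} \<subseteq> {..<n}" by (auto simp: words_def)
    then have "finite {i. x i \<noteq> 0}" by (rule finite_subset) simp
    moreover have "x i \<in> {0..<int p}" for i
      using x assms by (cases "i < n") (auto simp: words_def)
    ultimately show "x \<in> carrier (Fp_omega p)" using assms by (simp add: carrier_Fp_omega)
  qed
qed

lemma one_Fp_omega: "\<one>\<^bsub>Fp_omega p\<^esub> = (\<lambda>_. 0)"
  by (simp add: Fp_omega_def restrict_def)

text \<open>
  The sets are subgroups that exhaust the group, so each translation eventually fixes them.
\<close>

lemma Folner_sequence_words:
  assumes "p > 0" "mono N" "\<And>j. j \<le> N j"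
  shows "Folner_sequence (Fp_omega p) (\<lambda>j. words p {..<N j})"
  unfolding Folner_sequence_def
proof (intro conjI allI ballI)
  fix j
  show "finite (words p {..<N j})" by (rule finite_words) simp
  have "(\<lambda>_. 0) \<in> words p {..<N j}" using assms(1) by (simp add: words_def)
  then show "words p {..<N j} \<noteq> {}" by blast
  show "words p {..<N j} \<subseteq> carrier (Fp_omega p)"
    using assms(1) by (auto simp: carrier_Fp_omega_eq_words)
next
  interpret comm_group "Fp_omega p" by (rule comm_group_Fp_omega)
  fix g assume g: "g \<in> carrier (Fp_omega p)"
  then obtain n where n: "g \<in> words p {..<n}" using assms(1) by (auto simp: carrier_Fp_omega_eq_words)
  have "\<forall>\<^sub>F j in sequentially. real (card ((words p {..<N j} #>\<^bsub>Fp_omega p\<^esub> g) \<inter> words p {..<N j}))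
      / real (card (words p {..<N j})) = 1"
    using eventually_ge_at_top[of n]
  proof eventually_elim
    case (elim j)
    let ?W = "words p {..<N j}"
    have nN: "n \<le> N j" using elim assms(3)[of j] by linarith
    have "(\<lambda>x. x \<otimes>\<^bsub>Fp_omega p\<^esub> g) ` ?W = ?W"
    proof (rule endo_inj_surj)
      show "finite ?W" by (rule finite_words) simp
      show "(\<lambda>x. x \<otimes>\<^bsub>Fp_omega p\<^esub> g) ` ?W \<subseteq> ?W"
        using n nN assms(1) by (auto simp: mult_Fp_omega words_def)
      show "inj_on (\<lambda>x. x \<otimes>\<^bsub>Fp_omega p\<^esub> g) ?W"
        by (rule inj_on_subset[OF inj_on_multc[OF g]])
          (use assms(1) in \<open>auto simp: carrier_Fp_omega_eq_words\<close>)
    qed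
    moreover have "?W #>\<^bsub>Fp_omega p\<^esub> g = (\<lambda>x. x \<otimes>\<^bsub>Fp_omega p\<^esub> g) ` ?W"
      by (auto simp: r_coset_def)
    ultimately have "?W #>\<^bsub>Fp_omega p\<^esub> g = ?W" by simp
    then show ?case using assms(1) by (simp add: card_words)
  qed
  then show "(\<lambda>j. real (card ((words p {..<N j} #>\<^bsub>Fp_omega p\<^esub> g) \<inter> words p {..<N j}))
      / real (card (words p {..<N j}))) \<longlonglongrightarrow> 1"
    by (rule tendsto_eventually)
qed

section \<open>Zero-one vectors in Bohr sets\<close>

text \<open>
  Take \<open>J\<close> of minimal size among the sets whose removal trivializes all products; the removal of all
  of \<open>B\<close> shows that there is one. The products over the initial segments of \<open>J\<close> take values in a
  finite set whose size \<open>q\<close> is independent of \<open>B\<close>. If \<open>J\<close> had more than \<open>q\<close> elements, two segments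
  would have equal products; all products over their difference would then be \<open>1\<close>, and it could be
  restored to \<open>B\<close>, contradicting minimality.
\<close>

lemma delete_few_to_trivialize_products:
  fixes \<phi> :: "'l \<Rightarrow> 'a \<Rightarrow> complex"
  assumes "finite L" "p > 0" "\<And>l i. l \<in> L \<Longrightarrow> \<phi> l i ^ p = 1"
  shows "\<exists>q. \<forall>B. finite B \<longrightarrow> (\<exists>J\<subseteq>B. card J \<le> q \<and> (\<forall>l\<in>L. prod (\<phi> l) (B - J) = 1))"
proof (rule exI, intro allI impI)
  let ?R = "PiE L (\<lambda>_. {z::complex. z ^ p = 1})"
  fix B :: "'a set" assume B: "finite B"
  have "finite ?R"
    using assms(1,2) by (intro finite_PiE finite_roots_unity) auto
  let ?P = "\<lambda>J. J \<subseteq> B \<and> (\<forall>l\<in>L. prod (\<phi> l) (B - J) = 1)"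
  have "?P B" by simp
  then obtain J where J: "?P J" and min: "\<And>J'. ?P J' \<Longrightarrow> card J \<le> card J'"
    using ex_has_least_nat[of ?P B card] by blast
  have "finite J" using J B finite_subset by blast
  then obtain e where e: "bij_betw e {0..<card J} J" using ex_bij_betw_nat_finite by blast
  have "card J \<le> card ?R"
  proof (rule ccontr)
    assume "\<not> card J \<le> card ?R"
    define F where "F = (\<lambda>k. restrict (\<lambda>l. prod (\<phi> l) (e ` {0..<k})) L)"
    have "F ` {..card J} \<subseteq> ?R"
    proof (rule image_subsetI)
      fix k
      have "prod (\<phi> l) (e ` {0..<k}) ^ p = 1" if "l \<in> L" for l
        using assms(3)[OF that] by (simp add: prod_power_distrib)
      then show "F k \<in> ?R" by (auto simp: F_def)
    qed
    then have "card (F ` {..card J}) \<le> card ?R" using \<open>finite ?R\<close> by (rule card_mono[rotated])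
    with \<open>\<not> card J \<le> card ?R\<close> have "card (F ` {..card J}) < card {..card J}" by simp
    then have "\<not> inj_on F {..card J}" by (rule pigeonhole)
    then obtain m m' where m: "m \<le> card J" "m' \<le> card J" "F m = F m'" "m \<noteq> m'"
      by (auto simp: inj_on_def)
    obtain k k' where k: "k < k'" "k' \<le> card J" "F k = F k'"
    proof (cases "m < m'")
      case True
      with m that[of m m'] show thesis by simp
    next
      case False
      with m that[of m' m] show thesis by simp
    qed
    let ?D = "e ` {0..<k'} - e ` {0..<k}"
    have eJ: "e ` {0..<k'} \<subseteq> J" using e k(2) by (fastforce simp: bij_betw_def)
    have inj: "inj_on e {0..<k'}" using e k(2) inj_on_subset[of e "{0..<card J}" "{0..<k'}"] by (simp add: bij_betw_def)
    have "e k \<in> ?D" using inj_on_image_mem_iff[OF inj, of k "{0..<k}"] k(1) by auto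
    have D: "prod (\<phi> l) ?D = 1" if "l \<in> L" for l
    proof -
      have "prod (\<phi> l) (e ` {0..<k'}) = prod (\<phi> l) (e ` {0..<k})"
        using fun_cong[OF k(3), of l] that by (simp add: F_def)
      moreover have "prod (\<phi> l) (e ` {0..<k'}) = prod (\<phi> l) ?D * prod (\<phi> l) (e ` {0..<k})"
        using k(1) by (intro prod.subset_diff) auto
      moreover have "\<phi> l i \<noteq> 0" for i using assms(2) assms(3)[OF that, of i] by (auto simp: zero_power)
      then have "prod (\<phi> l) (e ` {0..<k}) \<noteq> 0" by simp
      ultimately show ?thesis by simp
    qed
    have "?P (J - ?D)"
    proof (intro conjI ballI)
      show "J - ?D \<subseteq> B" using J by blast
      fix l assume l: "l \<in> L"
      have "B - (J - ?D) = (B - J) \<union> ?D" using J eJ by blast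
      moreover have "prod (\<phi> l) ((B - J) \<union> ?D) = prod (\<phi> l) (B - J) * prod (\<phi> l) ?D"
        by (rule prod.union_disjoint) (use B eJ in auto)
      ultimately have "prod (\<phi> l) (B - (J - ?D)) = prod (\<phi> l) (B - J) * prod (\<phi> l) ?D" by simp
      then show "prod (\<phi> l) (B - (J - ?D)) = 1" using D[OF l] J l by simp
    qed
    then have "card J \<le> card (J - ?D)" by (rule min)
    moreover have "card (J - ?D) < card J"
      using \<open>e k \<in> ?D\<close> eJ \<open>finite J\<close> by (intro psubset_card_mono) auto
    ultimately show False by simp
  qed
  then show "\<exists>J\<subseteq>B. card J \<le> card ?R \<and> (\<forall>l\<in>L. prod (\<phi> l) (B - J) = 1)" using J by blast
qed

definition zero_one :: "nat set \<Rightarrow> nat \<Rightarrow> int" where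
  "zero_one J = (\<lambda>i. if i \<in> J then 1 else 0)"

lemma zero_one_carrier:
  assumes "p \<ge> 2" "finite J"
  shows "zero_one J \<in> carrier (Fp_omega p)"
  using assms by (simp add: carrier_Fp_omega zero_one_def)

lemma hom_circle_mult:
  assumes "\<psi> \<in> hom (Fp_omega p) circle_group" "x \<in> carrier (Fp_omega p)" "y \<in> carrier (Fp_omega p)"
  shows "\<psi> (x \<otimes>\<^bsub>Fp_omega p\<^esub> y) = \<psi> x * \<psi> y"
  using assms by (simp add: hom_def circle_group_def)

lemma hom_circle_zero:
  assumes "\<psi> \<in> hom (Fp_omega p) circle_group"
  shows "\<psi> (\<lambda>_. 0) = 1"
proof -
  interpret comm_group "Fp_omega p" by (rule comm_group_Fp_omega)
  have "\<psi> \<one>\<^bsub>Fp_omega p\<^esub> * \<psi> \<one>\<^bsub>Fp_omega p\<^esub> = \<psi> \<one>\<^bsub>Fp_omega p\<^esub>"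
    using hom_circle_mult[OF assms one_closed one_closed] by simp
  moreover have "cmod (\<psi> \<one>\<^bsub>Fp_omega p\<^esub>) = 1"
    using hom_in_carrier[OF assms one_closed] by (simp add: circle_group_def)
  then have "\<psi> \<one>\<^bsub>Fp_omega p\<^esub> \<noteq> 0" by auto
  ultimately show ?thesis by (simp add: one_Fp_omega)
qed

text \<open>
  The root of unity comes from \<open>p\<close>-fold addition of the unit vector, which gives zero.
\<close>

lemma hom_circle_unit_root:
  assumes "\<psi> \<in> hom (Fp_omega p) circle_group" "p \<ge> 2"
  shows "\<psi> (zero_one {i}) ^ p = 1"
proof -
  have "\<psi> (\<lambda>l. if l = i then int m mod int p else 0) = \<psi> (zero_one {i}) ^ m" for m
  proof (induction m)
    case 0
    then show ?case using hom_circle_zero[OF assms(1)] by (simp cong: if_cong)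
  next
    case (Suc m)
    let ?v = "\<lambda>l. if l = i then int m mod int p else 0"
    have "{l. ?v l \<noteq> 0} \<subseteq> {i}" by auto
    then have "finite {l. ?v l \<noteq> 0}" by (rule finite_subset) simp
    then have v: "?v \<in> carrier (Fp_omega p)" using assms(2) by (auto simp: carrier_Fp_omega)
    have "zero_one {i} \<otimes>\<^bsub>Fp_omega p\<^esub> ?v = (\<lambda>l. if l = i then int (Suc m) mod int p else 0)"
      using assms(2) by (auto simp: mult_Fp_omega zero_one_def mod_simps)
    with hom_circle_mult[OF assms(1) zero_one_carrier[OF assms(2), of "{i}"] v] Suc
    show ?case by simp
  qed
  from this[of p] hom_circle_zero[OF assms(1)] show ?thesis by (simp cong: if_cong)
qed

lemma hom_circle_zero_one:
  assumes "\<psi> \<in> hom (Fp_omega p) circle_group" "p \<ge> 2" "finite J"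
  shows "\<psi> (zero_one J) = (\<Prod>i\<in>J. \<psi> (zero_one {i}))"
  using assms(3)
proof (induction J rule: finite_induct)
  case empty
  then show ?case using hom_circle_zero[OF assms(1)] by (simp add: zero_one_def)
next
  case (insert i J)
  have "zero_one (insert i J) = zero_one {i} \<otimes>\<^bsub>Fp_omega p\<^esub> zero_one J"
    using insert.hyps(2) assms(2) by (auto simp: mult_Fp_omega zero_one_def)
  then show ?case
    using hom_circle_mult[OF assms(1) zero_one_carrier zero_one_carrier] insert assms(2) by simp
qed

text \<open>
  The bound \<open>q\<close> depends on the Bohr set alone, so it is eventually beaten by the number \<open>j\<close> of zeros
  that block \<open>j\<close> tolerates.
\<close>

lemma Bohr_set_contains_almost_full_zero_one:
  assumes "Bohr_set (Fp_omega p) U" "p \<ge> 2"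
  shows "\<exists>q. \<forall>B. finite B \<longrightarrow> (\<exists>J\<subseteq>B. card J \<le> q \<and> zero_one (B - J) \<in> U)"
proof -
  obtain \<epsilon> :: real and k :: nat and \<psi> where "\<epsilon> > 0"
    and hom: "\<And>l. l \<in> {1..k} \<Longrightarrow> \<psi> l \<in> hom (Fp_omega p) circle_group"
    and U: "U = {g \<in> carrier (Fp_omega p). \<forall>l\<in>{1..k}. cmod (\<psi> l g - 1) < \<epsilon>}"
    using assms(1) unfolding Bohr_set_def by blast
  have "\<exists>q. \<forall>B. finite B \<longrightarrow>
      (\<exists>J\<subseteq>B. card J \<le> q \<and> (\<forall>l\<in>{1..k}. (\<Prod>i\<in>B - J. \<psi> l (zero_one {i})) = 1))"
    using assms(2) hom_circle_unit_root[OF hom]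
    by (intro delete_few_to_trivialize_products[where p = p]) auto
  then obtain q where q: "\<And>B. finite B \<Longrightarrow>
      \<exists>J\<subseteq>B. card J \<le> q \<and> (\<forall>l\<in>{1..k}. (\<Prod>i\<in>B - J. \<psi> l (zero_one {i})) = 1)" by blast
  have "\<exists>J\<subseteq>B. card J \<le> q \<and> zero_one (B - J) \<in> U" if B: "finite B" for B
  proof -
    obtain J where J: "J \<subseteq> B" "card J \<le> q"
      "\<And>l. l \<in> {1..k} \<Longrightarrow> (\<Prod>i\<in>B - J. \<psi> l (zero_one {i})) = 1" using q[OF B] by blast
    have "\<psi> l (zero_one (B - J)) = 1" if "l \<in> {1..k}" for l
      using hom_circle_zero_one[OF hom[OF that] assms(2), of "B - J"] J(3)[OF that] B by simp
    then have "zero_one (B - J) \<in> U"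
      using U \<open>\<epsilon> > 0\<close> zero_one_carrier[OF assms(2), of "B - J"] B by simp
    with J show ?thesis by blast
  qed
  then show ?thesis by blast
qed

section \<open>Properties of the tower\<close>

lemma (in block_tower) tower_subset: "tower \<subseteq> carrier (Fp_omega p)"
  using two_le_p by (auto simp: tower_def carrier_Fp_omega_eq_words)

text \<open>
  Recurrence of every \<open>g\<close> among the vectors \<open>h j\<close> is what handles translates of Bohr sets: for a
  suitable \<open>j\<close> the translate by \<open>g = h j\<close> contains a vector that block \<open>j\<close> was built to avoid.
\<close>

lemma (in block_tower) no_Bohr_neighborhood_in_difference_set:
  assumes recurrent: "\<And>g q. g \<in> carrier (Fp_omega p) \<Longrightarrow> \<exists>j\<ge>q. h j = g"
    and B: "Bohr_neighborhood (Fp_omega p) B"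
  shows "\<not> B \<subseteq> difference_set (Fp_omega p) tower"
proof
  assume sub: "B \<subseteq> difference_set (Fp_omega p) tower"
  interpret comm_group "Fp_omega p" by (rule comm_group_Fp_omega)
  from B obtain g U where g: "g \<in> carrier (Fp_omega p)" and U: "Bohr_set (Fp_omega p) U"
    and gU: "g <#\<^bsub>Fp_omega p\<^esub> U \<subseteq> B" unfolding Bohr_neighborhood_def by blast
  obtain q where q: "\<And>B. finite B \<Longrightarrow> \<exists>J\<subseteq>B. card J \<le> q \<and> zero_one (B - J) \<in> U"
    using Bohr_set_contains_almost_full_zero_one[OF U two_le_p] by blast
  obtain j where j: "j \<ge> q" "h j = g" using recurrent[OF g] by blast
  obtain J where J: "J \<subseteq> block j" "card J \<le> q" "zero_one (block j - J) \<in> U"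
    using q[of "block j"] by auto
  let ?u = "zero_one (block j - J)" and ?s = "g \<otimes>\<^bsub>Fp_omega p\<^esub> zero_one (block j - J)"
  have "?s \<in> g <#\<^bsub>Fp_omega p\<^esub> U" using J(3) by (auto simp: l_coset_def)
  then obtain a b where ab: "a \<in> tower" "b \<in> tower" "?s = a \<otimes>\<^bsub>Fp_omega p\<^esub> inv\<^bsub>Fp_omega p\<^esub> b"
    using gU sub unfolding difference_set_def by blast
  have carr: "a \<in> carrier (Fp_omega p)" "b \<in> carrier (Fp_omega p)" using ab tower_subset by auto
  then have "?s \<otimes>\<^bsub>Fp_omega p\<^esub> b = a" by (simp add: ab(3) m_assoc)
  then have a: "a i = (?s i + b i) mod int p" for i
    using two_le_p by (auto simp: mult_Fp_omega)
  have gi: "g i \<in> {0..<int p}" for i using g two_le_p by (simp add: carrier_Fp_omega)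
  have s: "?s i = (g i + ?u i) mod int p" for i using two_le_p by (simp add: mult_Fp_omega)
  have g0: "g i = 0" if "N j \<le> i" for i using h_eq_0[OF that] j(2) by simp
  have "\<exists>i. a i mod int p \<noteq> (b i + ?s i) mod int p"
  proof (rule tower_avoids[OF _ _ _ ab(2,1)])
    show "?s i = h j i" if "i < N j" for i
      using that gi[of i] unfolding s by (simp add: j(2) zero_one_def block_def)
    show "?s i = 0" if "N (Suc j) \<le> i" for i
      using that N_mono[of j "Suc j"] unfolding s by (simp add: zero_one_def block_def g0)
    have "{i \<in> block j. ?s i \<noteq> 1} \<subseteq> J"
      using two_le_p unfolding s by (auto simp: zero_one_def block_def g0)
    then have "card {i \<in> block j. ?s i \<noteq> 1} \<le> card J"
      using J(1) finite_subset[OF J(1)] by (intro card_mono) auto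
    then show "card {i \<in> block j. ?s i \<noteq> 1} \<le> j" using J(2) j(1) by linarith
  qed
  then show False by (simp add: a add.commute)
qed

text \<open>
  The losses \<open>\<eta> / 2 ^ Suc i\<close> for \<open>i < j\<close> add up to \<open>\<eta> * (1 - 1 / 2 ^ j)\<close>.
\<close>

lemma (in block_tower) level_density_ge:
  assumes "\<eta> \<ge> 0" and few: "\<And>j. real (card {z \<in> words p (block j). \<nexists>a. wins p (block j) (2 * j) z a})
    \<le> \<eta> / 2 ^ Suc j * real p ^ card (block j)"
  shows "level_density j \<ge> level_density 0 - \<eta> * (1 - 1 / 2 ^ j)"
proof (induction j)
  case (Suc j)
  have "level_density (Suc j) \<ge> level_density j - \<eta> / 2 ^ Suc j"
    by (rule level_density_Suc[OF few])
  with Suc show ?case by (simp add: algebra_simps)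
qed simp

lemma (in block_tower) upper_Banach_density_tower:
  assumes "\<eta> \<ge> 0" and few: "\<And>j. real (card {z \<in> words p (block j). \<nexists>a. wins p (block j) (2 * j) z a})
    \<le> \<eta> / 2 ^ Suc j * real p ^ card (block j)"
  shows "upper_Banach_density (Fp_omega p) tower \<ge> ereal (1 / 2 - 1 / (2 * real p) - \<eta>)"
proof -
  let ?d = "\<lambda>j. ereal (real (card (tower \<inter> words p {..<N j})) / real (card (words p {..<N j})))"
  have d: "ereal (1 / 2 - 1 / (2 * real p) - \<eta>) \<le> ?d j" for j
  proof -
    have "\<eta> * (1 - 1 / 2 ^ j) \<le> \<eta>" using assms(1) by (simp add: algebra_simps)
    then show ?thesis
      using level_density_ge[OF assms, of j] tower_density[of j] level_density_0 by simp
  qed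
  have "ereal (1 / 2 - 1 / (2 * real p) - \<eta>) \<le> liminf ?d"
    by (intro Liminf_bounded always_eventually allI d)
  also have "\<dots> \<le> limsup ?d" by (rule Liminf_le_Limsup) simp
  also have "\<dots> \<le> upper_Banach_density (Fp_omega p) tower"
    unfolding upper_Banach_density_def
    using Folner_sequence_words[of p N] two_le_p le_N N_mono
    by (intro SUP_upper2[of "\<lambda>j. words p {..<N j}"]) (auto simp: mono_def)
  finally show ?thesis .
qed

section \<open>Choice of the parameters\<close>

text \<open>
  The pairing function repeats each element of the countable group infinitely often. An element
  whose turn comes before \<open>N j\<close> exceeds its support is replaced by \<open>0\<close>; it returns later.
\<close>

lemma recurrent_enumeration:
  assumes "p > 0" "\<And>j. j \<le> N j"
  obtains h where "\<And>j. h j \<in> words p {..<N j}"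
    and "\<And>g q. g \<in> carrier (Fp_omega p) \<Longrightarrow> \<exists>j\<ge>q. h j = g"
proof -
  have "countable (carrier (Fp_omega p))"
    unfolding carrier_Fp_omega_eq_words[OF assms(1)]
    by (intro countable_UN) (auto intro: countable_finite finite_words)
  moreover define e where "e = from_nat_into (carrier (Fp_omega p))"
  ultimately have e: "carrier (Fp_omega p) \<subseteq> range e"
    using subset_range_from_nat_into by blast
  define h where "h j = (let g = e (fst (prod_decode j)) in if g \<in> words p {..<N j} then g else (\<lambda>_. 0))" for j
  show thesis
  proof
    show "h j \<in> words p {..<N j}" for j
      using assms(1) by (simp add: h_def Let_def) (simp add: words_def)
    fix g q assume g: "g \<in> carrier (Fp_omega p)"
    then obtain i where i: "g = e i" using e by blast
    obtain n where n: "g \<in> words p {..<n}" using g assms(1) by (auto simp: carrier_Fp_omega_eq_words)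
    define j where "j = prod_encode (i, max n q)"
    have "max n q \<le> j" unfolding j_def by (rule le_prod_encode_2)
    then have "n \<le> N j" "q \<le> j" using assms(2)[of j] by auto
    then have "g \<in> words p {..<N j}"
      using n assms(1) by (auto simp: words_def)
    then have "h j = g" by (simp add: h_def j_def i)
    with \<open>q \<le> j\<close> show "\<exists>j\<ge>q. h j = g" by blast
  qed
qed

theorem theorem1p4:
  fixes p :: nat and c :: real
  assumes "Factorial_Ring.prime p"
    and "c < 1 / 2 - 1 / (2 * real p)"
  shows "\<exists>A \<subseteq> carrier (Fp_omega p).
           upper_Banach_density (Fp_omega p) A > ereal c \<and>
           \<not> (\<exists>B. Bohr_neighborhood (Fp_omega p) B \<and> B \<subseteq> difference_set (Fp_omega p) A)"
proof -
  have p: "p \<ge> 2" using assms(1) by (rule prime_ge_2_nat)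
  \<comment> \<open>The total loss of density may be at most half of the gap to \<open>c\<close>, which keeps the inequality strict.\<close>
  define \<eta> where "\<eta> = (1 / 2 - 1 / (2 * real p) - c) / 2"
  have \<eta>: "\<eta> > 0" using assms(2) by (simp add: \<eta>_def)
  have "\<forall>j. \<exists>n. \<forall>m\<ge>n. \<forall>I. finite I \<and> card I = m \<longrightarrow>
      real (card {x \<in> words p I. \<nexists>a. wins p I (2 * j) x a}) \<le> \<eta> / 2 ^ Suc j * real p ^ m"
  proof
    show "\<exists>n. \<forall>m\<ge>n. \<forall>I. finite I \<and> card I = m \<longrightarrow>
        real (card {x \<in> words p I. \<nexists>a. wins p I (2 * j) x a}) \<le> \<eta> / 2 ^ Suc j * real p ^ m" for j
      using eventually_few_without_winner[of p "\<eta> / 2 ^ Suc j" "2 * j"] p \<eta>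
      unfolding eventually_sequentially by simp
  qed
  from choice[OF this] obtain n where n: "\<forall>j. \<forall>m\<ge>n j. \<forall>I. finite I \<and> card I = m \<longrightarrow>
      real (card {x \<in> words p I. \<nexists>a. wins p I (2 * j) x a}) \<le> \<eta> / 2 ^ Suc j * real p ^ m" ..
  \<comment> \<open>Block \<open>j\<close> has length \<open>n j + 2 * j + 1\<close>: long enough for few ties, and longer than \<open>2 * j\<close>.\<close>
  define N where "N j = 1 + (\<Sum>i<j. n i + 2 * i + 1)" for j
  have N_step: "N (Suc j) = N j + (n j + 2 * j + 1)" for j by (simp add: N_def)
  have le_N: "j \<le> N j" for j by (induction j) (simp_all add: N_step)
  obtain h where h: "\<And>j. h j \<in> words p {..<N j}"
    and recurrent: "\<And>g q. g \<in> carrier (Fp_omega p) \<Longrightarrow> \<exists>j\<ge>q. h j = g"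
    using recurrent_enumeration[of p N] p le_N by auto
  interpret block_tower p N h
  proof
    show "2 \<le> p" by (rule p)
    show "N 0 = 1" by (simp add: N_def)
    show "N j + 2 * j < N (Suc j)" for j by (simp add: N_step)
    show "h j i = 0" if "N j \<le> i" for j i using h[of j] that by (simp add: words_def)
  qed
  have "real (card {z \<in> words p (block j). \<nexists>a. wins p (block j) (2 * j) z a})
      \<le> \<eta> / 2 ^ Suc j * real p ^ card (block j)" for j
  proof -
    have "n j \<le> card (block j)" by (simp add: block_def N_step)
    then show ?thesis using n by simp
  qed
  then have "ereal (1 / 2 - 1 / (2 * real p) - \<eta>) \<le> upper_Banach_density (Fp_omega p) tower"
    using \<eta> by (intro upper_Banach_density_tower) auto
  moreover have "ereal c < ereal (1 / 2 - 1 / (2 * real p) - \<eta>)"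
  proof -
    have "c < x - (x - c) / 2" if "c < x" for x :: real using that by (simp add: field_simps)
    from this[OF assms(2)] show ?thesis by (simp only: less_ereal.simps \<eta>_def)
  qed
  ultimately have "ereal c < upper_Banach_density (Fp_omega p) tower"
    by (rule less_le_trans[rotated])
  then show ?thesis
    using tower_subset no_Bohr_neighborhood_in_difference_set[OF recurrent] by blast
qed

end
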